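(* We have $V_2(2,n)=(1+o(1))\,n^2\log_2 n$ as $n\to\infty$. Moreover, for every fixed $q\ge 2$ there are constants $c_q,c_q'>0$ such that for all integers $n\ge 2$, $$c_q n^q\log n\le V_2(q,n)\le c_q' n^q\log n.$$
   Context: The vertex online Ramsey number $V_2(q,n)$ is defined by the following game between builder and painter. At the start of stage $t\ge 1$ a new vertex $v_t$ is added; for each earlier vertex $v_i$, $i<t$, builder decides (in any order) whether to draw the edge $v_iv_t$, and painter must immediately color each drawn edge with one of $q$ colors. A monochromatic monotone path of length $n$ is a sequence $v_{a_1},\dots,v_{a_n}$ with $a_1<\dots<a_n$ such that all edges $v_{a_i}v_{a_{i+1}}$ are drawn and have the same color. $V_2(q,n)$ is the minimum number of edges builder must draw to guarantee a monochromatic monotone path of length $n$ regardless of painter's strategy. Logarithms are base 2 unless indicated. *)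

theory Defs
  imports Complex_Main "HOL-Library.Landau_Symbols"
begin

text \<open>
  A history of the game lists its events, most recent first. The vertices are \<open>1, 2, 3, \<dots>\<close>
  in order of appearance. \<open>Edge i c\<close> records that the edge between \<open>i\<close> and the vertex
  of the current stage was drawn and received colour \<open>c\<close>.
\<close>

datatype event = Vertex | Edge nat nat

type_synonym history = "event list"

fun num_vertices :: "history \<Rightarrow> nat" where
  "num_vertices [] = 0"
| "num_vertices (Vertex # h) = Suc (num_vertices h)"
| "num_vertices (Edge i c # h) = num_vertices h"

fun colouring :: "history \<Rightarrow> nat \<times> nat \<Rightarrow> nat option" where
  "colouring [] = Map.empty"
| "colouring (Vertex # h) = colouring h"
| "colouring (Edge i c # h) = (colouring h)((i, num_vertices h) \<mapsto> c)"

definition drawn_edges :: "history \<Rightarrow> (nat \<times> nat) set" where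
  "drawn_edges h = dom (colouring h)"

text \<open>
  In stage \<open>t\<close>, builder either draws another edge \<open>(i, t)\<close> or starts stage \<open>t + 1\<close>,
  thereby deciding not to draw the remaining edges at \<open>t\<close>. Both players' moves may depend on
  the whole history, so edges are chosen adaptively and in any order.
\<close>

datatype move = New_Vertex | Draw nat

definition builder_strategy :: "(history \<Rightarrow> move) \<Rightarrow> bool" where
  "builder_strategy \<beta> \<longleftrightarrow>
     (\<forall>h i. \<beta> h = Draw i \<longrightarrow>
        1 \<le> i \<and> i < num_vertices h \<and> (i, num_vertices h) \<notin> drawn_edges h)"

definition painter_strategy :: "nat \<Rightarrow> (history \<Rightarrow> nat \<Rightarrow> nat) \<Rightarrow> bool" where
  "painter_strategy q \<pi> \<longleftrightarrow> (\<forall>h i. \<pi> h i < q)"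

definition step :: "(history \<Rightarrow> move) \<Rightarrow> (history \<Rightarrow> nat \<Rightarrow> nat) \<Rightarrow> history \<Rightarrow> history" where
  "step \<beta> \<pi> h = (case \<beta> h of New_Vertex \<Rightarrow> Vertex # h | Draw i \<Rightarrow> Edge i (\<pi> h i) # h)"

definition play :: "(history \<Rightarrow> move) \<Rightarrow> (history \<Rightarrow> nat \<Rightarrow> nat) \<Rightarrow> nat \<Rightarrow> history" where
  "play \<beta> \<pi> k = (step \<beta> \<pi> ^^ k) []"

text \<open>The length of a path is its number of vertices.\<close>

definition has_mono_path :: "nat \<Rightarrow> history \<Rightarrow> bool" where
  "has_mono_path n h \<longleftrightarrow>
     (\<exists>a c. strict_mono_on {1..n} a \<and> a ` {1..n} \<subseteq> {1..num_vertices h} \<and>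
        (\<forall>i\<in>{1..<n}. colouring h (a i, a (i + 1)) = Some c))"

definition builder_guarantees :: "nat \<Rightarrow> nat \<Rightarrow> nat \<Rightarrow> bool" where
  "builder_guarantees q n m \<longleftrightarrow>
     (\<exists>\<beta>. builder_strategy \<beta> \<and>
        (\<forall>\<pi>. painter_strategy q \<pi> \<longrightarrow>
           (\<exists>k. has_mono_path n (play \<beta> \<pi> k) \<and> card (drawn_edges (play \<beta> \<pi> k)) \<le> m)))"

definition V2 :: "nat \<Rightarrow> nat \<Rightarrow> nat" where
  "V2 q n = (LEAST m. builder_guarantees q n m)"

end

theory Submission
  imports Defs "HOL-Library.FuncSet" "HOL-Real_Asymp.Real_Asymp"
begin

text \<open>
  Label every vertex by the lengths of the longest monotone paths ending there, one coordinate per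
  colour. An edge of colour \<open>c\<close> from \<open>w\<close> pushes the \<open>c\<close>-th coordinate of the new vertex above
  that of \<open>w\<close>.

  Builder makes sure that no new label lies below an old one, so the labels are distinct and at
  most \<open>(n - 1) ^ q\<close> stages end before a path of length \<open>n\<close> appears. The maximal old labels which
  still dominate the new one have a coordinatewise median; querying it removes a fraction
  \<open>1 / q\<close> of them, whatever the answer. For \<open>q = 2\<close> the maximal labels form an antichain of size
  less than \<open>n\<close>, hence about \<open>log 2 n\<close> queries suffice.

  Painter fills the grid \<open>[n - 1] ^ q\<close> antidiagonal by antidiagonal. Every query leaves the current
  vertex an interval of the antidiagonal which contains at least half of the remaining free points.
  At the end of the stage it is put on an occupied point of this interval if there is one (which
  costs painter nothing), and otherwise on the midpoint. If few edges were drawn the interval is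
  long, so the points obtained cheaply are far apart and therefore few; all other points cost
  builder \<open>(1 - o(1)) * log 2 n\<close> edges each.
\<close>

section \<open>Legal histories and invariants of plays\<close>

inductive legal :: "nat \<Rightarrow> history \<Rightarrow> bool" for q where
  legal_Nil: "legal q []"
| legal_Vertex: "legal q h \<Longrightarrow> legal q (Vertex # h)"
| legal_Edge: "\<lbrakk>legal q h; 1 \<le> i; i < num_vertices h; (i, num_vertices h) \<notin> drawn_edges h; c < q\<rbrakk>
    \<Longrightarrow> legal q (Edge i c # h)"

lemma play_0 [simp]: "play \<beta> \<pi> 0 = []"
  by (simp add: play_def)

lemma play_Suc [simp]: "play \<beta> \<pi> (Suc k) = step \<beta> \<pi> (play \<beta> \<pi> k)"
  by (simp add: play_def)

lemma length_play [simp]: "length (play \<beta> \<pi> k) = k"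
  by (induction k) (auto simp: step_def split: move.split)

lemma drawn_edges_simps [simp]:
  "drawn_edges [] = {}"
  "drawn_edges (Vertex # h) = drawn_edges h"
  "drawn_edges (Edge i c # h) = insert (i, num_vertices h) (drawn_edges h)"
  by (auto simp: drawn_edges_def)

lemma finite_drawn_edges [simp]: "finite (drawn_edges h)"
proof (induction h)
  case (Cons e h)
  then show ?case by (cases e) auto
qed simp

lemma legal_step:
  assumes "builder_strategy \<beta>" "painter_strategy q \<pi>" "legal q h"
  shows "legal q (step \<beta> \<pi> h)"
  using assms unfolding step_def builder_strategy_def painter_strategy_def
  by (auto split: move.split intro: legal.intros)

lemma legal_play:
  assumes "builder_strategy \<beta>" "painter_strategy q \<pi>"
  shows "legal q (play \<beta> \<pi> k)"
  by (induction k) (auto intro: legal_Nil legal_step assms)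

lemma legal_colouring:
  assumes "legal q h" "colouring h (i, j) = Some c"
  shows "1 \<le> i \<and> i < j \<and> j \<le> num_vertices h \<and> c < q"
  using assms by (induction) (auto split: if_splits)

text \<open>Every legal event adds a vertex or a fresh edge. A play with boundedly many vertices and
  edges is therefore short, which forces builder's play to reach a path.\<close>

lemma length_legal: "legal q h \<Longrightarrow> length h = num_vertices h + card (drawn_edges h)"
  by (induction rule: legal.induct) auto

text \<open>Painter chooses any colour that keeps \<open>I\<close>, and the default colour 0 where
  none does. Since \<open>I\<close> may hide existential witnesses, painter's private bookkeeping
  need not be computed from the history.\<close>

lemma painter_strategy_of_invariant:
  assumes "0 < q" and Nil: "I []" and Vertex: "\<And>h. I h \<Longrightarrow> I (Vertex # h)"
    and Edge: "\<And>h i. \<lbrakk>I h; 1 \<le> i; i < num_vertices h; (i, num_vertices h) \<notin> drawn_edges h\<rbrakk>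
      \<Longrightarrow> \<exists>c<q. I (Edge i c # h)"
  obtains \<pi> where "painter_strategy q \<pi>" "\<And>\<beta> k. builder_strategy \<beta> \<Longrightarrow> I (play \<beta> \<pi> k)"
proof -
  define \<pi> where "\<pi> h i = (if \<exists>c<q. I (Edge i c # h) then SOME c. c < q \<and> I (Edge i c # h) else 0)"
    for h i
  have sel: "\<pi> h i < q \<and> I (Edge i (\<pi> h i) # h)" if "\<exists>c<q. I (Edge i c # h)" for h i
    using someI_ex[of "\<lambda>c. c < q \<and> I (Edge i c # h)"] that unfolding \<pi>_def by auto
  have "painter_strategy q \<pi>"
    unfolding painter_strategy_def using sel \<open>0 < q\<close> \<pi>_def by metis
  moreover have "I (play \<beta> \<pi> k)" if "builder_strategy \<beta>" for \<beta> k
  proof (induction k)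
    case (Suc k)
    then show ?case
      using that sel Edge Vertex unfolding builder_strategy_def
      by (fastforce simp: step_def split: move.split)
  qed (use Nil in simp)
  ultimately show ?thesis by (rule that)
qed

lemma has_mono_path_imp_drawn:
  assumes "has_mono_path n h" "2 \<le> n"
  shows "0 < card (drawn_edges h)"
proof -
  from assms(1) obtain a c where "\<forall>i\<in>{1..<n}. colouring h (a i, a (i + 1)) = Some c"
    unfolding has_mono_path_def by blast
  then have "colouring h (a 1, a (1 + 1)) = Some c" using assms(2) by simp
  then have "(a 1, a (1 + 1)) \<in> drawn_edges h" by (auto simp: drawn_edges_def)
  then show ?thesis by (auto simp: card_gt_0_iff)
qed

text \<open>Along a path of colour \<open>c\<close> the \<open>c\<close>-th label rises by at least
  1 per edge, so its last vertex would have label at least \<open>n - 1\<close>, which is at least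
  \<open>N\<close>.\<close>

lemma no_mono_path_of_labelling:
  assumes lt: "\<And>i j c. colouring h (i, j) = Some c \<Longrightarrow> f i c < f j c"
    and bound: "\<And>v c. f v c < N"
    and n: "N < n" "2 \<le> n"
  shows "\<not> has_mono_path n h"
proof
  assume "has_mono_path n h"
  then obtain a c where a: "\<forall>i\<in>{1..<n}. colouring h (a i, a (i + 1)) = Some c"
    unfolding has_mono_path_def by blast
  have "k < n \<Longrightarrow> k \<le> f (a (Suc k)) c" for k
  proof (induction k)
    case (Suc k)
    then have "colouring h (a (Suc k), a (Suc k + 1)) = Some c" using a by simp
    from lt[OF this] Suc show ?case by simp
  qed simp
  from this[of "n - 1"] n bound[of "a n" c] show False by (auto simp: le_less_trans)
qed

section \<open>Builder\<close>

text \<open>\<open>lab h v c\<close> is the number of vertices of a longest monotone path of colour \<open>c\<close> ending at \<open>v\<close>.\<close>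

fun lab :: "history \<Rightarrow> nat \<Rightarrow> nat \<Rightarrow> nat" where
  "lab [] v c = 1"
| "lab (Vertex # h) v c = lab h v c"
| "lab (Edge i d # h) v c =
     (if v = num_vertices h \<and> c = d then max (lab h v c) (Suc (lab h i c)) else lab h v c)"

lemma lab_pos: "1 \<le> lab h v c"
proof (induction h)
  case (Cons e h)
  then show ?case by (cases e) auto
qed simp

text \<open>An edge event only raises the label of the current vertex. No drawn edge starts there,
  so the inequalities for earlier edges persist.\<close>

lemma lab_less_of_edge:
  assumes "legal q h" "colouring h (i, j) = Some c"
  shows "lab h i c < lab h j c"
  using assms by (induction) (auto split: if_splits dest: legal_colouring)

section \<open>Paths realising the labels\<close>

definition path_to :: "history \<Rightarrow> nat \<Rightarrow> nat \<Rightarrow> nat \<Rightarrow> bool" where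
  "path_to h c v k \<longleftrightarrow> (\<exists>a. strict_mono_on {1..k} a \<and> a ` {1..k} \<subseteq> {1..v} \<and> a k = v \<and>
     (\<forall>i\<in>{1..<k}. colouring h (a i, a (i + 1)) = Some c))"

lemma path_to_mono:
  assumes "path_to h c v k" "colouring h \<subseteq>\<^sub>m colouring h'"
  shows "path_to h' c v k"
  using assms unfolding path_to_def map_le_def by (metis domI)

lemma path_to_snoc:
  assumes "path_to h c v k" "colouring h (v, w) = Some c" "v < w" "1 \<le> k"
  shows "path_to h c w (Suc k)"
proof -
  obtain a where a: "strict_mono_on {1..k} a" "a ` {1..k} \<subseteq> {1..v}" "a k = v"
    "\<forall>i\<in>{1..<k}. colouring h (a i, a (i + 1)) = Some c"
    using assms(1) unfolding path_to_def by blast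
  have le: "1 \<le> a i \<and> a i \<le> v" if "1 \<le> i" "i \<le> k" for i
    using a(2) that by (auto simp: image_subset_iff)
  let ?b = "a(Suc k := w)"
  have "strict_mono_on {1..Suc k} ?b"
  proof (rule strict_mono_onI)
    fix r s assume rs: "r \<in> {1..Suc k}" "s \<in> {1..Suc k}" "r < s"
    show "?b r < ?b s"
    proof (cases "s = Suc k")
      case True
      then show ?thesis using rs le[of r] assms(3) by auto
    next
      case False
      then show ?thesis using rs strict_mono_onD[OF a(1), of r s] by auto
    qed
  qed
  moreover have "?b ` {1..Suc k} \<subseteq> {1..w}"
    using le assms(3) by (force simp: image_subset_iff)
  moreover have "\<forall>i\<in>{1..<Suc k}. colouring h (?b i, ?b (i + 1)) = Some c"
    using a(3,4) assms(2) by (auto simp: less_Suc_eq)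
  ultimately show ?thesis unfolding path_to_def by (intro exI[of _ ?b]) auto
qed

lemma colouring_Edge_mono:
  "(i, num_vertices h) \<notin> drawn_edges h \<Longrightarrow> colouring h \<subseteq>\<^sub>m colouring (Edge i c # h)"
  by (auto simp: map_le_def drawn_edges_def)

text \<open>A label is attained by a real path: when an edge raises it, the path realising the label
  of the left endpoint is extended by that edge.\<close>

lemma path_to_lab:
  assumes "legal q h" "1 \<le> v"
  shows "path_to h c v (lab h v c)"
  using assms
proof (induction arbitrary: v)
  case legal_Nil
  then show ?case by (auto simp: path_to_def strict_mono_on_def intro!: exI[of _ "\<lambda>_. v"])
next
  case (legal_Vertex h)
  then show ?case by (simp add: path_to_def)
next
  case (legal_Edge h i d)
  note mono = path_to_mono[OF _ colouring_Edge_mono[OF legal_Edge.hyps(4)]]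
  show ?case
  proof (cases "v = num_vertices h \<and> c = d \<and> lab h v c < Suc (lab h i c)")
    case True
    have "path_to (Edge i d # h) c i (lab h i c)"
      using legal_Edge.IH[OF legal_Edge.hyps(2)] by (rule mono)
    moreover have "lab (Edge i d # h) v c = Suc (lab h i c)" using True by auto
    ultimately show ?thesis
      using path_to_snoc[of "Edge i d # h" c i "lab h i c" v] True lab_pos[of h i c] legal_Edge.hyps(3)
      by simp
  next
    case False
    then show ?thesis using mono[OF legal_Edge.IH[OF legal_Edge.prems]] by (auto simp: max_def)
  qed
qed

lemma path_to_take:
  assumes "path_to h c v k" "n \<le> k" "v \<le> num_vertices h" "1 \<le> n"
  shows "has_mono_path n h"
proof -
  obtain a where a: "strict_mono_on {1..k} a" "a ` {1..k} \<subseteq> {1..v}"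
    "\<forall>i\<in>{1..<k}. colouring h (a i, a (i + 1)) = Some c"
    using assms(1) unfolding path_to_def by blast
  have "strict_mono_on {1..n} a" using a(1) assms(2) by (auto simp: strict_mono_on_def)
  moreover have "a ` {1..n} \<subseteq> {1..num_vertices h}"
    using a(2) assms(2,3) by (fastforce simp: image_subset_iff)
  ultimately show ?thesis using a(3) assms(2) unfolding has_mono_path_def by (intro exI[of _ a] exI[of _ c]) auto
qed

lemma lab_less_of_no_path:
  assumes "legal q h" "\<not> has_mono_path n h" "1 \<le> v" "v \<le> num_vertices h" "1 \<le> n"
  shows "lab h v c < n"
  using path_to_take[OF path_to_lab[OF assms(1,3)], of n c] assms by force

text \<open>Call \<open>w\<close> bad for \<open>c\<close> if more than a fraction (q - 1)/q of
  \<open>S\<close> lies above it in coordinate \<open>c\<close>. The highest bad element has all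
  these points outside \<open>B c\<close>, so \<open>B c\<close> is smaller than
  \<open>card S / q\<close>, and the \<open>q\<close> bad sets cannot cover
  \<open>S\<close>.\<close>

lemma exists_median:
  fixes x :: "'a \<Rightarrow> nat \<Rightarrow> nat"
  assumes "finite S" "S \<noteq> {}" "0 < q"
  obtains w where "w \<in> S" "\<And>c. c < q \<Longrightarrow> q * card {v\<in>S. x w c < x v c} \<le> (q - 1) * card S"
proof -
  define B where "B c = {w\<in>S. (q - 1) * card S < q * card {v\<in>S. x w c < x v c}}" for c
  have B: "q * card (B c) < card S" for c
  proof (cases "B c = {}")
    case True
    then show ?thesis using assms by (simp add: card_gt_0_iff)
  next
    case False
    have "finite (B c)" using assms(1) by (simp add: B_def)
    then have "Max ((\<lambda>v. x v c) ` B c) \<in> (\<lambda>v. x v c) ` B c" using False by (intro Max_in) auto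
    then obtain w where "w \<in> B c" "x w c = Max ((\<lambda>v. x v c) ` B c)" by auto
    then have w: "w \<in> B c" "\<And>v. v \<in> B c \<Longrightarrow> x v c \<le> x w c"
      using \<open>finite (B c)\<close> by auto
    let ?G = "{v\<in>S. x w c < x v c}"
    have "B c \<inter> ?G = {}" using w(2) by fastforce
    moreover have "B c \<subseteq> S" "?G \<subseteq> S" by (auto simp: B_def)
    ultimately have "card (B c) + card ?G \<le> card S"
      using assms(1) by (metis (no_types, lifting) Un_least card_Un_disjoint card_mono finite_subset)
    then have "q * card (B c) + q * card ?G \<le> q * card S"
      by (metis add_mult_distrib2 mult_le_mono2)
    moreover have "(q - 1) * card S < q * card ?G" using w(1) by (simp add: B_def)
    moreover have "q * card S = (q - 1) * card S + card S" using assms(3) by (cases q) auto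
    ultimately show ?thesis by linarith
  qed
  have "q * card (\<Union>c<q. B c) \<le> (\<Sum>c<q. q * card (B c))"
    using card_UN_le[of "{..<q}" B] by (simp add: sum_distrib_left[symmetric])
  also have "\<dots> < (\<Sum>c<q. card S)" using B assms(3) by (intro sum_strict_mono) auto
  finally have "card (\<Union>c<q. B c) < card S" by simp
  moreover have "(\<Union>c<q. B c) \<subseteq> S" by (auto simp: B_def)
  ultimately obtain w where "w \<in> S" "w \<notin> (\<Union>c<q. B c)" by (metis less_irrefl subset_antisym subsetI)
  then show ?thesis by (intro that[of w]) (auto simp: B_def not_less)
qed

section \<open>Builder's median strategy\<close>

definition dominated :: "nat \<Rightarrow> history \<Rightarrow> nat \<Rightarrow> nat \<Rightarrow> bool" where
  "dominated q h v u \<longleftrightarrow> (\<forall>c<q. lab h v c \<le> lab h u c)"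

text \<open>The current vertex is left out, so this set stays fixed throughout a stage.\<close>

definition maximal_vertices :: "nat \<Rightarrow> history \<Rightarrow> nat set" where
  "maximal_vertices q h =
     {v\<in>{1..<num_vertices h}. \<forall>u\<in>{1..<num_vertices h}. u \<noteq> v \<longrightarrow> \<not> dominated q h v u}"

definition candidates :: "nat \<Rightarrow> history \<Rightarrow> nat set" where
  "candidates q h = {v\<in>maximal_vertices q h. dominated q h (num_vertices h) v}"

definition good_query :: "nat \<Rightarrow> history \<Rightarrow> nat \<Rightarrow> bool" where
  "good_query q h i \<longleftrightarrow> i \<in> candidates q h \<and> (i, num_vertices h) \<notin> drawn_edges h \<and>
     (\<forall>c<q. q * card {v\<in>candidates q h. lab h i c < lab h v c} \<le> (q - 1) * card (candidates q h))"

definition builder :: "nat \<Rightarrow> history \<Rightarrow> move" where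
  "builder q h = (if \<exists>i. good_query q h i then Draw (SOME i. good_query q h i) else New_Vertex)"

lemma builder_Draw: "builder q h = Draw i \<Longrightarrow> good_query q h i"
  unfolding builder_def by (auto split: if_splits intro: someI)

lemma candidates_bounds: "i \<in> candidates q h \<Longrightarrow> 1 \<le> i \<and> i < num_vertices h"
  by (auto simp: candidates_def maximal_vertices_def)

lemma finite_maximal_vertices [simp]: "finite (maximal_vertices q h)"
  by (simp add: maximal_vertices_def)

lemma finite_candidates [simp]: "finite (candidates q h)"
  by (simp add: candidates_def)

lemma builder_strategy_builder: "builder_strategy (builder q)"
  unfolding builder_strategy_def
  using builder_Draw candidates_bounds unfolding good_query_def by blast

text \<open>A median of the candidates is always available as a query: a drawn edge from it would
  have lifted the current label above its own in some colour, so it would no longer be a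
  candidate.\<close>

lemma builder_New_Vertex:
  assumes "legal q h" "builder q h = New_Vertex" "0 < q"
  shows "candidates q h = {}"
proof (rule ccontr)
  assume "candidates q h \<noteq> {}"
  then obtain w where w: "w \<in> candidates q h"
    "\<And>c. c < q \<Longrightarrow> q * card {v\<in>candidates q h. lab h w c < lab h v c} \<le> (q - 1) * card (candidates q h)"
    using exists_median[of "candidates q h" q "lab h"] assms(3) by auto
  have "(w, num_vertices h) \<notin> drawn_edges h"
  proof
    assume "(w, num_vertices h) \<in> drawn_edges h"
    then obtain c where c: "colouring h (w, num_vertices h) = Some c"
      by (auto simp: drawn_edges_def)
    then have "lab h w c < lab h (num_vertices h) c" "c < q"
      using lab_less_of_edge legal_colouring assms(1) by blast+
    then show False using w(1) by (auto simp: candidates_def dominated_def not_le[symmetric])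
  qed
  then have "good_query q h w" using w by (simp add: good_query_def)
  then show False using assms(2) by (auto simp: builder_def split: if_splits)
qed

lemma maximal_vertices_Edge [simp]: "maximal_vertices q (Edge i c # h) = maximal_vertices q h"
  by (auto simp: maximal_vertices_def dominated_def)

text \<open>The answer \<open>c\<close> lifts the current label above that of \<open>i\<close> in
  coordinate \<open>c\<close>, so exactly the candidates strictly above \<open>i\<close> there
  survive.\<close>

lemma candidates_Edge:
  assumes "c < q"
  shows "candidates q (Edge i c # h) = {v\<in>candidates q h. lab h i c < lab h v c}"
proof -
  have "v < num_vertices h" if "v \<in> maximal_vertices q h" for v
    using that by (auto simp: maximal_vertices_def)
  then show ?thesis
    using assms by (fastforce simp: candidates_def dominated_def split: if_splits)
qed

text \<open>Finished labels appear in an order compatible with the product order, without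
  repetition. The current vertex is exempt until its stage ends.\<close>

definition increasing :: "nat \<Rightarrow> history \<Rightarrow> bool" where
  "increasing q h \<longleftrightarrow> (\<forall>u v. 1 \<le> u \<longrightarrow> u < v \<longrightarrow> v < num_vertices h \<longrightarrow> \<not> dominated q h v u)"

text \<open>The latest earlier vertex \<open>w\<close> dominating the current one would be a
  candidate. Whatever dominates \<open>w\<close> also dominates the current vertex, hence is not
  later than \<open>w\<close>, and an earlier one contradicts \<open>increasing\<close>.\<close>

lemma not_dominated_of_candidates_empty:
  assumes inc: "increasing q h" and empty: "candidates q h = {}"
    and u: "1 \<le> u" "u < num_vertices h"
  shows "\<not> dominated q h (num_vertices h) u"
proof
  let ?t = "num_vertices h"
  assume dom: "dominated q h ?t u"
  let ?D = "{u\<in>{1..<?t}. dominated q h ?t u}"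
  have fin: "finite ?D" and ne: "?D \<noteq> {}" using u dom by auto
  define w where "w = Max ?D"
  have w: "w \<in> ?D" using Max_in[OF fin ne] by (simp add: w_def)
  have "\<not> dominated q h w v" if v: "v \<in> {1..<?t}" "v \<noteq> w" for v
  proof
    assume d: "dominated q h w v"
    then have "v \<in> ?D" using v w unfolding dominated_def by (auto intro: order_trans)
    then have "v \<le> w" unfolding w_def by (rule Max_ge[OF fin])
    then have "v < w" using v by simp
    then show False using inc d v w unfolding increasing_def by auto
  qed
  then have "w \<in> candidates q h" using w by (auto simp: candidates_def maximal_vertices_def)
  then show False using empty by simp
qed

text \<open>Here \<open>d\<close> counts the queries of the current stage and \<open>E\<close>
  limits them per stage. The last inequality says that each query kept at most a fraction (q - 1)/q
  of the candidates.\<close>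

definition builder_inv :: "nat \<Rightarrow> nat \<Rightarrow> history \<Rightarrow> bool" where
  "builder_inv q E h \<longleftrightarrow> legal q h \<and> increasing q h \<and>
     (\<exists>d\<le>E. card (drawn_edges h) \<le> num_vertices h * E + d \<and>
        q ^ d * card (candidates q h) \<le> (q - 1) ^ d * card (maximal_vertices q h))"

lemma builder_inv_step:
  assumes inv: "builder_inv q E h" and \<pi>: "painter_strategy q \<pi>" and q: "0 < q"
    and E: "\<And>d. q ^ d \<le> (q - 1) ^ d * card (maximal_vertices q h) \<Longrightarrow> d < E"
  shows "builder_inv q E (step (builder q) \<pi> h)"
proof -
  have leg: "legal q h" and inc: "increasing q h" using inv by (auto simp: builder_inv_def)
  have leg': "legal q (step (builder q) \<pi> h)"
    using legal_step[OF builder_strategy_builder \<pi> leg] .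
  obtain d where d: "d \<le> E" "card (drawn_edges h) \<le> num_vertices h * E + d"
    "q ^ d * card (candidates q h) \<le> (q - 1) ^ d * card (maximal_vertices q h)"
    using inv by (auto simp: builder_inv_def)
  show ?thesis
  proof (cases "builder q h")
    case New_Vertex
    have "increasing q (Vertex # h)"
      using inc not_dominated_of_candidates_empty[OF inc builder_New_Vertex[OF leg New_Vertex q]]
      by (auto simp: increasing_def dominated_def less_Suc_eq)
    moreover have "card (candidates q (Vertex # h)) \<le> card (maximal_vertices q (Vertex # h))"
      by (rule card_mono) (auto simp: candidates_def)
    ultimately show ?thesis
      using New_Vertex leg' d(1,2) by (auto simp: builder_inv_def step_def intro!: exI[of _ 0])
  next
    case (Draw i)
    define c where "c = \<pi> h i"
    have c: "c < q" using \<pi> by (simp add: painter_strategy_def c_def)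
    have g: "good_query q h i" using builder_Draw[OF Draw] .
    then have i: "i \<in> candidates q h" "(i, num_vertices h) \<notin> drawn_edges h"
      by (auto simp: good_query_def)
    \<comment> \<open>The queried vertex is itself a candidate, so the shrinking inequality turns
      into a bound on \<open>d\<close>, leaving room for one more query.\<close>
    have "1 \<le> card (candidates q h)"
      using i(1) by (metis One_nat_def Suc_leI card_gt_0_iff empty_iff finite_candidates)
    then have "q ^ d \<le> q ^ d * card (candidates q h)" by simp
    then have "d < E" using d(3) by (intro E) (rule order_trans)
    moreover have "q ^ Suc d * card (candidates q (Edge i c # h))
        \<le> (q - 1) ^ Suc d * card (maximal_vertices q (Edge i c # h))"
    proof -
      have "q ^ Suc d * card (candidates q (Edge i c # h))
          = q ^ d * (q * card {v\<in>candidates q h. lab h i c < lab h v c})"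
        by (simp add: candidates_Edge[OF c])
      also have "\<dots> \<le> q ^ d * ((q - 1) * card (candidates q h))"
        using g c by (intro mult_le_mono2) (simp add: good_query_def)
      also have "\<dots> = (q - 1) * (q ^ d * card (candidates q h))" by simp
      also have "\<dots> \<le> (q - 1) * ((q - 1) ^ d * card (maximal_vertices q h))"
        using d(3) by (rule mult_le_mono2)
      finally show ?thesis by simp
    qed
    moreover have "increasing q (Edge i c # h)"
      using inc by (auto simp: increasing_def dominated_def)
    ultimately show ?thesis
      using Draw leg' d(2) i(2)
      by (auto simp: builder_inv_def step_def c_def[symmetric] intro!: exI[of _ "Suc d"])
  qed
qed

text \<open>Equal labels dominate each other, so finished labels are distinct, and each of their
  \<open>q\<close> coordinates lies in \<open>{1..<n}\<close>.\<close>

lemma card_vertices_le: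
  assumes inc: "increasing q h" and lt: "\<And>v c. 1 \<le> v \<Longrightarrow> v \<le> num_vertices h \<Longrightarrow> lab h v c < n"
  shows "card {1..<num_vertices h} \<le> (n - 1) ^ q"
proof -
  let ?f = "\<lambda>v. restrict (lab h v) {..<q}"
  have "?f v \<noteq> ?f u" if "1 \<le> u" "u < v" "v < num_vertices h" for u v
  proof
    assume eq: "?f v = ?f u"
    have "lab h v c = lab h u c" if "c < q" for c
      using fun_cong[OF eq, of c] that by simp
    then have "dominated q h v u" by (simp add: dominated_def)
    then show False using inc that unfolding increasing_def by blast
  qed
  then have "inj_on ?f {1..<num_vertices h}"
    by (intro linorder_inj_onI') (metis atLeastLessThan_iff)
  moreover have "?f ` {1..<num_vertices h} \<subseteq> {..<q} \<rightarrow>\<^sub>E {1..<n}"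
    using lt lab_pos by (auto simp: restrict_def PiE_def extensional_def)
  ultimately have "card {1..<num_vertices h} \<le> card ({..<q} \<rightarrow>\<^sub>E {1..<n})"
    by (intro card_inj_on_le) (auto intro: finite_PiE)
  then show ?thesis by (simp add: card_PiE)
qed

text \<open>With two colours, vertices that agree in coordinate 0 are comparable, so coordinate 0 is
  injective on the antichain of maximal vertices.\<close>

lemma card_maximal_vertices_two:
  assumes "\<And>v c. 1 \<le> v \<Longrightarrow> v \<le> num_vertices h \<Longrightarrow> lab h v c < n"
  shows "card (maximal_vertices 2 h) \<le> n"
proof -
  have "inj_on (\<lambda>v. lab h v 0) (maximal_vertices 2 h)"
  proof (rule inj_onI, rule ccontr)
    fix u v assume uv: "u \<in> maximal_vertices 2 h" "v \<in> maximal_vertices 2 h"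
      "lab h u 0 = lab h v 0" "u \<noteq> v"
    then have "\<not> dominated 2 h u v" "\<not> dominated 2 h v u" by (auto simp: maximal_vertices_def)
    then show False using uv(3) by (auto simp: dominated_def numeral_2_eq_2 less_Suc_eq)
  qed
  moreover have "(\<lambda>v. lab h v 0) ` maximal_vertices 2 h \<subseteq> {..<n}"
    using assms by (auto simp: maximal_vertices_def)
  ultimately have "card (maximal_vertices 2 h) \<le> card {..<n}" by (rule card_inj_on_le) simp
  then show ?thesis by simp
qed

text \<open>Until a path appears there are at most \<open>(n - 1) ^ q + 1\<close> vertices with at
  most \<open>E\<close> queries each. \<open>E\<close> must exceed every number of shrinkings that
  leaves a candidate, starting from at most \<open>n\<close> of them for \<open>q = 2\<close> and at
  most \<open>n ^ q\<close> otherwise.\<close>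

lemma builder_guarantees_bound:
  assumes "2 \<le> q" "2 \<le> n"
    and E: "\<And>d. q \<noteq> 2 \<Longrightarrow> q ^ d \<le> (q - 1) ^ d * n ^ q \<Longrightarrow> d < E"
      "\<And>d. q = 2 \<Longrightarrow> 2 ^ d \<le> n \<Longrightarrow> d < E"
  shows "builder_guarantees q n (((n - 1) ^ q + 2) * E + 1)"
  unfolding builder_guarantees_def
proof (intro exI[of _ "builder q"] conjI allI impI builder_strategy_builder)
  fix \<pi> assume \<pi>: "painter_strategy q \<pi>"
  let ?p = "play (builder q) \<pi>"
  have leg: "legal q (?p k)" for k using legal_play[OF builder_strategy_builder \<pi>] .
  have inv: "builder_inv q E (?p k)" if "\<forall>j<k. \<not> has_mono_path n (?p j)" for k
    using that
  proof (induction k)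
    case 0
    then show ?case
      by (auto simp: builder_inv_def legal_Nil increasing_def candidates_def maximal_vertices_def)
  next
    case (Suc k)
    then have inv: "builder_inv q E (?p k)" and no: "\<not> has_mono_path n (?p k)" by auto
    have lt: "lab (?p k) v c < n" if "1 \<le> v" "v \<le> num_vertices (?p k)" for v c
      using lab_less_of_no_path[OF leg no that] assms(2) by simp
    have "d < E" if d: "q ^ d \<le> (q - 1) ^ d * card (maximal_vertices q (?p k))" for d
    proof (cases "q = 2")
      case True
      then show ?thesis using d card_maximal_vertices_two[OF lt] by (intro E(2)) auto
    next
      case False
      have "card (maximal_vertices q (?p k)) \<le> card {1..<num_vertices (?p k)}"
        by (rule card_mono) (auto simp: maximal_vertices_def)
      also have "\<dots> \<le> (n - 1) ^ q"
        using inv lt by (intro card_vertices_le) (auto simp: builder_inv_def)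
      also have "\<dots> \<le> n ^ q" by (intro power_mono) auto
      finally show ?thesis using d False by (intro E(1)) (auto intro: order_trans mult_le_mono2)
    qed
    then show ?case using builder_inv_step[OF inv \<pi>] assms(1) by simp
  qed
  have bound: "num_vertices (?p k) \<le> (n - 1) ^ q + 1 \<and>
      card (drawn_edges (?p k)) \<le> ((n - 1) ^ q + 2) * E" if no: "\<forall>j\<le>k. \<not> has_mono_path n (?p j)" for k
  proof -
    have inv: "builder_inv q E (?p k)" using inv no by simp
    have lt: "lab (?p k) v c < n" if "1 \<le> v" "v \<le> num_vertices (?p k)" for v c
      using lab_less_of_no_path[OF leg _ that] no assms(2) by simp
    have "card {1..<num_vertices (?p k)} \<le> (n - 1) ^ q"
      using inv lt by (intro card_vertices_le) (auto simp: builder_inv_def)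
    then have t: "num_vertices (?p k) \<le> (n - 1) ^ q + 1" by simp
    obtain d where "d \<le> E" "card (drawn_edges (?p k)) \<le> num_vertices (?p k) * E + d"
      using inv by (auto simp: builder_inv_def)
    moreover have "num_vertices (?p k) * E \<le> ((n - 1) ^ q + 1) * E" using t by (rule mult_le_mono1)
    ultimately show ?thesis using t by (simp add: algebra_simps)
  qed
  have "\<exists>k. has_mono_path n (?p k)"
  proof (rule ccontr)
    assume no: "\<nexists>k. has_mono_path n (?p k)"
    \<comment> \<open>One more than the sum of the bounds on vertices and edges, hence too long for
      a play without a path.\<close>
    define k where "k = Suc ((n - 1) ^ q + 1 + ((n - 1) ^ q + 2) * E)"
    have "num_vertices (?p k) \<le> (n - 1) ^ q + 1" "card (drawn_edges (?p k)) \<le> ((n - 1) ^ q + 2) * E"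
      using bound[of k] no by blast+
    then show False using length_legal[OF leg, of k] unfolding length_play by (simp add: k_def)
  qed
  then obtain k where k: "has_mono_path n (?p k)" "\<forall>j<k. \<not> has_mono_path n (?p j)"
    using exists_least_iff[of "\<lambda>k. has_mono_path n (?p k)"] by auto
  have "k \<noteq> 0" using has_mono_path_imp_drawn[OF k(1) assms(2)] by (cases k) auto
  then obtain j where j: "k = Suc j" by (cases k) auto
  \<comment> \<open>The bounds hold just before the first path appears. The move completing it
    accounts for the final \<open>+ 1\<close>.\<close>
  have "card (drawn_edges (?p k)) \<le> Suc (card (drawn_edges (?p j)))"
    by (auto simp: j step_def card_insert_if split: move.split)
  then show "\<exists>k. has_mono_path n (?p k) \<and> card (drawn_edges (?p k)) \<le> ((n - 1) ^ q + 2) * E + 1"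
    using bound[of j] k j by (intro exI[of _ k]) auto
qed

section \<open>Painter\<close>

text \<open>Each block of \<open>R\<close> consecutive numbers contains at most one element of
  \<open>C\<close>.\<close>

lemma card_separated_le:
  fixes C :: "nat set"
  assumes "C \<subseteq> {..<N}" "0 < R" and sep: "\<And>x y. \<lbrakk>x \<in> C; y \<in> C; x < y\<rbrakk> \<Longrightarrow> x + R \<le> y"
  shows "card C \<le> N div R + 1"
proof -
  have "x div R \<noteq> y div R" if "x \<in> C" "y \<in> C" "x < y" for x y
  proof -
    have "x div R + 1 = (x + R) div R" using assms(2) by simp
    also have "\<dots> \<le> y div R" using sep[OF that] by (rule div_le_mono)
    finally show ?thesis by simp
  qed
  then have "inj_on (\<lambda>x. x div R) C" by (rule linorder_inj_onI')
  moreover have "(\<lambda>x. x div R) ` C \<subseteq> {..N div R}"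
    using assms(1) by (auto intro!: div_le_mono simp: subset_iff less_imp_le)
  ultimately have "card C \<le> card {..N div R}" by (rule card_inj_on_le) simp
  then show ?thesis by simp
qed

text \<open>
  Line \<open>l\<close> consists of the points with index \<open>x \<in> {lo l..<hi l}\<close>, the point having the colour
  coordinates \<open>pos l x\<close>. By \<open>order\<close>, an edge from an earlier point to a vertex whose position on
  line \<open>l\<close> is still open can be coloured so that only the positions on one side are lost.
\<close>

locale line_system =
  fixes q N M R K Y X :: nat and lo hi :: "nat \<Rightarrow> nat" and pos :: "nat \<Rightarrow> nat \<Rightarrow> nat \<Rightarrow> nat"
  assumes hi_le: "\<And>l. hi l \<le> N"
    and pos_less: "\<And>l x c. \<lbrakk>lo l \<le> x; x < hi l\<rbrakk> \<Longrightarrow> pos l x c < N"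
    and order: "\<And>l' l x'. \<lbrakk>l' \<le> l; l < M; lo l' \<le> x'; x' < hi l'\<rbrakk> \<Longrightarrow>
      \<exists>c\<^sub>1<q. \<exists>c\<^sub>2<q. \<forall>x. lo l \<le> x \<longrightarrow> x < hi l \<longrightarrow>
        (x < x' \<or> x = x' \<and> l' < l \<longrightarrow> pos l' x' c\<^sub>1 < pos l x c\<^sub>1) \<and>
        (x' < x \<longrightarrow> pos l' x' c\<^sub>2 < pos l x c\<^sub>2)"
    and M_pos: "0 < M" and q_pos: "0 < q" and N_pos: "0 < N" and R_pos: "0 < R"
    and Y_ge: "2 * R * 2 ^ K \<le> Y" and X_ge: "Y + N div R + 1 \<le> X"
begin

definition line :: "nat \<Rightarrow> nat set" where
  "line l = {lo l..<hi l}"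

text \<open>The number of points on the lines before \<open>l\<close> for which builder surely paid.
  Up to \<open>X\<close> points per line are written off; truncated subtraction lets short lines
  contribute 0.\<close>

definition weight :: "nat \<Rightarrow> nat" where
  "weight l = (\<Sum>k<l. card (line k) - X)"

text \<open>
  \<open>S\<close> is the set of occupied points of line \<open>l\<close>. All of them except the \<open>R\<close>-separated \<open>C\<close> cost
  builder at least \<open>K\<close> edges.
\<close>

definition filled :: "nat \<Rightarrow> nat set \<Rightarrow> nat set \<Rightarrow> nat \<Rightarrow> bool" where
  "filled l S C e \<longleftrightarrow> S \<subseteq> line l \<and> C \<subseteq> S \<and> (\<forall>x\<in>C. \<forall>y\<in>C. x < y \<longrightarrow> x + R \<le> y) \<and>
     K * (weight l + (card S - card C)) \<le> e"

lemma finite_line [simp]: "finite (line l)"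
  by (simp add: line_def)

lemma line_subset: "line l \<subseteq> {..<N}"
  using hi_le[of l] by (auto simp: line_def)

text \<open>A line with at most \<open>Y\<close> free points is abandoned. At most
  \<open>N div R + 1\<close> of its occupied points were cheap, so all but \<open>X\<close> of its
  points have been paid for. Painter moves on until a line has enough room or all \<open>M\<close>
  lines are paid.\<close>

lemma next_line:
  assumes "filled l S C e" "l < M"
  shows "K * weight M \<le> e \<or> (\<exists>l' S' C'. l \<le> l' \<and> l' < M \<and> filled l' S' C' e \<and>
    Y < card (line l' - S') \<and> (l' = l \<longrightarrow> S' = S))"
  using assms
proof (induction "M - l" arbitrary: l S C)
  case (Suc k)
  show ?case
  proof (cases "Y < card (line l - S)")
    case True
    then show ?thesis using Suc.prems by blast
  next
    case False
    have S: "S \<subseteq> line l" and C: "C \<subseteq> S" and sep: "\<forall>x\<in>C. \<forall>y\<in>C. x < y \<longrightarrow> x + R \<le> y"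
      and e: "K * (weight l + (card S - card C)) \<le> e"
      using Suc.prems by (auto simp: filled_def)
    have "card C \<le> N div R + 1"
      using S C line_subset[of l] sep R_pos by (intro card_separated_le) auto
    moreover have "card (line l - S) = card (line l) - card S"
      using S finite_subset[OF S] by (intro card_Diff_subset) auto
    ultimately have "card (line l) - X \<le> card S - card C" using False X_ge by linarith
    then have "K * weight (Suc l) \<le> K * (weight l + (card S - card C))" by (simp add: weight_def)
    with e have e': "K * weight (Suc l) \<le> e" by linarith
    show ?thesis
    proof (cases "Suc l < M")
      case True
      have "filled (Suc l) {} {} e" using e' by (simp add: filled_def)
      moreover have "k = M - Suc l" using Suc.hyps(2) by simp
      ultimately have "K * weight M \<le> e \<or> (\<exists>l' S' C'. Suc l \<le> l' \<and> l' < M \<and> filled l' S' C' e \<and>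
          Y < card (line l' - S'))"
        using Suc.hyps(1)[OF _ _ True] by blast
      then show ?thesis by (metis Suc_leD Suc_n_not_le_n)
    next
      case False
      then have "Suc l = M" using Suc.prems by simp
      then show ?thesis using e' by auto
    qed
  qed
qed simp

section \<open>Painter's state during a stage\<close>

definition labelled :: "history \<Rightarrow> nat \<Rightarrow> nat set \<Rightarrow> (nat \<Rightarrow> nat \<times> nat) \<Rightarrow> nat \<Rightarrow> bool" where
  "labelled h l S f t \<longleftrightarrow>
     (\<forall>v<t. fst (f v) \<le> l \<and> snd (f v) \<in> line (fst (f v)) \<and> (fst (f v) = l \<longrightarrow> snd (f v) \<in> S)) \<and>
     (\<forall>i j c. colouring h (i, j) = Some c \<longrightarrow> i < j \<and> j \<le> num_vertices h \<and>
        (j < t \<longrightarrow> pos (fst (f i)) (snd (f i)) c < pos (fst (f j)) (snd (f j)) c))"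

text \<open>
  The current vertex may still be put on every point of \<open>{a..<b}\<close>. Each of its \<open>d\<close> edges has at
  most halved the number of free points in this interval.
\<close>

definition undecided :: "history \<Rightarrow> nat \<Rightarrow> nat set \<Rightarrow> (nat \<Rightarrow> nat \<times> nat) \<Rightarrow> nat \<Rightarrow> nat \<Rightarrow> nat \<Rightarrow> bool" where
  "undecided h l S f a b d \<longleftrightarrow> {a..<b} \<subseteq> line l \<and>
     (\<forall>i c. colouring h (i, num_vertices h) = Some c \<longrightarrow>
        (\<forall>x\<in>{a..<b}. pos (fst (f i)) (snd (f i)) c < pos l x c)) \<and>
     Y < card (line l - S) \<and> card (line l - S) \<le> 2 ^ d * card ({a..<b} - S)"

text \<open>The \<open>d\<close> edges of the current stage are kept apart from the \<open>e\<close>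
  earlier ones, because they are charged only when the current vertex receives its point.\<close>

definition painter_state :: "history \<Rightarrow> bool" where
  "painter_state h \<longleftrightarrow> (\<exists>l S C f a b d e. l < M \<and> card (drawn_edges h) = e + d \<and>
     filled l S C e \<and> labelled h l S f (num_vertices h) \<and> undecided h l S f a b d)"

text \<open>Once builder has paid the target amount, painter may answer arbitrarily.\<close>

definition painter_inv :: "history \<Rightarrow> bool" where
  "painter_inv h \<longleftrightarrow> painter_state h \<or> K * weight M \<le> card (drawn_edges h)"

lemma painter_state_of_filled:
  assumes "filled l S C (card (drawn_edges h))" "l < M" "labelled h l S f (num_vertices h)"
    and none: "\<And>i. colouring h (i, num_vertices h) = None"
  shows "painter_inv h"
proof (cases "K * weight M \<le> card (drawn_edges h)")
  case True
  then show ?thesis by (simp add: painter_inv_def)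
next
  case False
  then obtain l' S' C' where l': "l \<le> l'" "l' < M" "filled l' S' C' (card (drawn_edges h))"
    "Y < card (line l' - S')" "l' = l \<longrightarrow> S' = S"
    using next_line[OF assms(1,2)] by blast
  \<comment> \<open>If the line has changed, no earlier vertex lies on the new one.\<close>
  have "fst (f v) = l' \<longrightarrow> snd (f v) \<in> S'" if "v < num_vertices h" for v
    using assms(3) l' that unfolding labelled_def by (metis order_antisym)
  moreover have "fst (f v) \<le> l'" if "v < num_vertices h" for v
    using assms(3) l'(1) that unfolding labelled_def by (meson order_trans)
  ultimately have "labelled h l' S' f (num_vertices h)"
    using assms(3) by (simp add: labelled_def)
  moreover have "undecided h l' S' f (lo l') (hi l') 0"
    using l'(4) none by (simp add: undecided_def line_def)
  ultimately have "painter_state h"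
    unfolding painter_state_def using l' by (metis add.right_neutral)
  then show ?thesis by (simp add: painter_inv_def)
qed

text \<open>The empty history already has a current vertex 0 in this bookkeeping, a phantom without
  edges that the first \<open>Vertex\<close> event places on a point.\<close>

lemma painter_inv_Nil: "painter_inv []"
  using M_pos by (intro painter_state_of_filled[of 0 "{}" "{}" _ "\<lambda>_. (0, 0)"])
    (auto simp: filled_def labelled_def weight_def)

lemma filled_insert:
  assumes "filled l S C e" "K \<le> d" "x \<in> line l" "x \<notin> S"
  shows "filled l (insert x S) C (e + d)"
proof -
  have fin: "finite S" using assms(1) by (auto simp: filled_def intro: finite_subset)
  have "card C \<le> card S" using assms(1) fin by (intro card_mono) (auto simp: filled_def)
  then have "card (insert x S) - card C = Suc (card S - card C)" using assms(4) fin by simp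
  then have "K * (weight l + (card (insert x S) - card C)) = K * (weight l + (card S - card C)) + K"
    by simp
  then show ?thesis using assms by (auto simp: filled_def)
qed

lemma filled_insert_separated:
  assumes "filled l S C e" "x \<in> line l" "x \<notin> S"
    and sep: "\<And>y. y \<in> S \<Longrightarrow> x + R \<le> y \<or> y + R \<le> x"
  shows "filled l (insert x S) (insert x C) (e + d)"
proof -
  have fin: "finite S" using assms(1) by (auto simp: filled_def intro: finite_subset)
  have CS: "C \<subseteq> S" using assms(1) by (simp add: filled_def)
  have "card (insert x S) - card (insert x C) = card S - card C"
    using assms(3) fin CS finite_subset[OF CS] by (auto simp: card_insert_if)
  moreover have "\<forall>y\<in>insert x C. \<forall>z\<in>insert x C. y < z \<longrightarrow> y + R \<le> z"
  proof (intro ballI impI)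
    fix y z assume yz: "y \<in> insert x C" "z \<in> insert x C" "y < z"
    consider "y = x" "z \<in> S" | "z = x" "y \<in> S" | "y \<in> C" "z \<in> C" using yz CS by auto
    then show "y + R \<le> z"
    proof cases
      case 3
      then show ?thesis using yz(3) assms(1) by (auto simp: filled_def)
    qed (use yz(3) sep[of y] sep[of z] in auto)
  qed
  ultimately show ?thesis using assms by (auto simp: filled_def)
qed

text \<open>An occupied point of the interval is reused without using up a new one. Otherwise the
  midpoint is taken: with \<open>K \<le> d\<close> the stage pays for it, and with fewer edges the
  interval is so long that the midpoint can join the separated set \<open>C\<close>.\<close>

lemma painter_state_choice:
  assumes "filled l S C e" "undecided h l S f a b d"
  obtains x S' C' where "x \<in> {a..<b}" "x \<in> S'" "S \<subseteq> S'" "filled l S' C' (e + d)"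
proof (cases "{a..<b} \<inter> S = {}")
  case False
  then obtain x where "x \<in> {a..<b}" "x \<in> S" by blast
  moreover have "filled l S C (e + d)" using assms(1) by (simp add: filled_def)
  ultimately show ?thesis using that by blast
next
  case disj: True
  then have "{a..<b} - S = {a..<b}" by auto
  then have Y: "Y < 2 ^ d * (b - a)" and sub: "{a..<b} \<subseteq> line l"
    using assms(2) by (auto simp: undecided_def)
  define x where "x = a + (b - a) div 2"
  have "0 < b - a" using Y by (cases "b - a") auto
  then have x: "x \<in> {a..<b}" by (auto simp: x_def)
  then have xl: "x \<in> line l" "x \<notin> S" using sub disj by auto
  show ?thesis
  proof (cases "K \<le> d")
    case True
    then show ?thesis using that[OF x _ _ filled_insert[OF assms(1) _ xl]] by auto
  next
    case False
    \<comment> \<open>The choice of \<open>Y\<close> makes an interval that was halved fewer than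
      \<open>K\<close> times longer than \<open>2 * R\<close>. As it contains no occupied point, all
      of these are at distance at least \<open>R\<close> from its midpoint.\<close>
    have "2 * R * 2 ^ K < 2 ^ d * (b - a)" using Y Y_ge by linarith
    also have "\<dots> \<le> 2 ^ K * (b - a)" using False by (intro mult_le_mono1) (simp add: power_increasing)
    finally have "2 * R < b - a" by (simp add: mult.commute)
    moreover have "y < a \<or> b \<le> y" if "y \<in> S" for y
      using that disj by (metis IntI atLeastLessThan_iff empty_iff linorder_not_less)
    ultimately have "x + R \<le> y \<or> y + R \<le> x" if "y \<in> S" for y
      using that by (fastforce simp: x_def)
    from filled_insert_separated[OF assms(1) xl this] show ?thesis using that[OF x] by blast
  qed
qed

lemma painter_inv_Vertex:
  assumes "painter_inv h"
  shows "painter_inv (Vertex # h)"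
proof (cases "painter_state h")
  case False
  then show ?thesis using assms by (simp add: painter_inv_def)
next
  case True
  let ?t = "num_vertices h"
  obtain l S C f a b d e where st: "l < M" "card (drawn_edges h) = e + d" "filled l S C e"
    "labelled h l S f ?t" "undecided h l S f a b d"
    using True unfolding painter_state_def by blast
  obtain x S' C' where x: "x \<in> {a..<b}" "x \<in> S'" "S \<subseteq> S'" "filled l S' C' (e + d)"
    using painter_state_choice[OF st(3,5)] by blast
  let ?f = "f(?t := (l, x))"
  have xl: "x \<in> line l" using st(5) x(1) by (auto simp: undecided_def)
  have none: "colouring h (i, Suc ?t) = None" for i
    using st(4) unfolding labelled_def by (metis not_None_eq not_less_eq_eq order_refl)
  have "pos (fst (?f i)) (snd (?f i)) c < pos (fst (?f j)) (snd (?f j)) c"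
    if c: "colouring h (i, j) = Some c" for i j c
  proof -
    have ij: "i < j" "j \<le> ?t" "j < ?t \<longrightarrow> pos (fst (f i)) (snd (f i)) c < pos (fst (f j)) (snd (f j)) c"
      using st(4) c by (auto simp: labelled_def)
    show ?thesis
    proof (cases "j = ?t")
      case True
      then show ?thesis using c ij st(5) x(1) by (auto simp: undecided_def)
    next
      case False
      then show ?thesis using ij by auto
    qed
  qed
  then have "labelled (Vertex # h) l S' ?f (num_vertices (Vertex # h))"
    using st(4) x xl unfolding labelled_def by (auto simp: less_Suc_eq intro: le_SucI)
  then show ?thesis
    using painter_state_of_filled[of l S' C' "Vertex # h" ?f] st(1,2) x(4) none by simp
qed

text \<open>The earlier point \<open>x'\<close> splits the interval. Colour \<open>c\<^sub>1\<close>
  keeps the part to its left and \<open>c\<^sub>2\<close> the part to its right; painter keeps the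
  part with more free points.\<close>

lemma painter_inv_Edge:
  assumes "painter_inv h" and i: "1 \<le> i" "i < num_vertices h" "(i, num_vertices h) \<notin> drawn_edges h"
  shows "\<exists>c<q. painter_inv (Edge i c # h)"
proof (cases "painter_state h")
  case False
  then show ?thesis using assms q_pos by (auto simp: painter_inv_def)
next
  case True
  let ?t = "num_vertices h"
  obtain l S C f a b d e where st: "l < M" "card (drawn_edges h) = e + d" "filled l S C e"
    "labelled h l S f ?t" "undecided h l S f a b d"
    using True unfolding painter_state_def by blast
  define l' x' where "l' = fst (f i)" and "x' = snd (f i)"
  have w: "l' \<le> l" "x' \<in> line l'" "l' = l \<longrightarrow> x' \<in> S"
    using st(4) i(2) by (auto simp: labelled_def l'_def x'_def)
  obtain c\<^sub>1 c\<^sub>2 where c: "c\<^sub>1 < q" "c\<^sub>2 < q"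
    "\<And>x. \<lbrakk>x \<in> line l; x < x' \<or> x = x' \<and> l' < l\<rbrakk> \<Longrightarrow> pos l' x' c\<^sub>1 < pos l x c\<^sub>1"
    "\<And>x. \<lbrakk>x \<in> line l; x' < x\<rbrakk> \<Longrightarrow> pos l' x' c\<^sub>2 < pos l x c\<^sub>2"
    using order[OF w(1) st(1), of x'] w(2) by (auto simp: line_def)
  have sub: "{a..<b} \<subseteq> line l" using st(5) by (simp add: undecided_def)
  \<comment> \<open>The index \<open>x'\<close> itself stays possible exactly when the earlier point
    is on an earlier line.\<close>
  define b' where "b' = min b (if l' < l then Suc x' else x')"
  define a' where "a' = max a (Suc x')"
  have go: "painter_inv (Edge i c # h)"
    if c: "\<And>x. x \<in> {u..<v} \<Longrightarrow> pos l' x' c < pos l x c" and uv: "{u..<v} \<subseteq> {a..<b}"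
      and half: "card ({a..<b} - S) \<le> 2 * card ({u..<v} - S)" for c u v
  proof -
    have "labelled (Edge i c # h) l S f (num_vertices (Edge i c # h))"
      using st(4) i by (auto simp: labelled_def)
    moreover have "undecided (Edge i c # h) l S f u v (Suc d)"
    proof -
      have "card (line l - S) \<le> 2 ^ d * card ({a..<b} - S)" using st(5) by (simp add: undecided_def)
      also have "\<dots> \<le> 2 ^ d * (2 * card ({u..<v} - S))" using half by (rule mult_le_mono2)
      finally have "card (line l - S) \<le> 2 ^ Suc d * card ({u..<v} - S)" by simp
      moreover have "pos (fst (f j)) (snd (f j)) k < pos l x k"
        if "colouring (Edge i c # h) (j, num_vertices h) = Some k" "x \<in> {u..<v}" for j k x
        using that st(5) uv c by (auto simp: undecided_def l'_def x'_def subset_iff split: if_splits)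
      ultimately show ?thesis using st(5) uv sub by (auto simp: undecided_def)
    qed
    moreover have "card (drawn_edges (Edge i c # h)) = e + Suc d" using i(3) st(2) by simp
    ultimately have "painter_state (Edge i c # h)"
      unfolding painter_state_def using st(1,3) by blast
    then show ?thesis by (simp add: painter_inv_def)
  qed
  \<comment> \<open>The two parts miss at most \<open>x'\<close>, and only when
    \<open>l' = l\<close>; then \<open>x'\<close> is occupied, so no free point is lost.\<close>
  have "x \<in> {a..<b'} \<union> {a'..<b}" if "x \<in> {a..<b}" "x \<notin> S" for x
    using that w(1,3) by (cases x x' rule: linorder_cases) (auto simp: a'_def b'_def)
  then have "{a..<b} - S \<subseteq> ({a..<b'} - S) \<union> ({a'..<b} - S)" by blast
  then have "card ({a..<b} - S) \<le> card (({a..<b'} - S) \<union> ({a'..<b} - S))" by (intro card_mono) auto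
  also have "\<dots> \<le> card ({a..<b'} - S) + card ({a'..<b} - S)" by (rule card_Un_le)
  finally consider "card ({a..<b} - S) \<le> 2 * card ({a..<b'} - S)"
    | "card ({a..<b} - S) \<le> 2 * card ({a'..<b} - S)" by linarith
  then show ?thesis
  proof cases
    case 1
    have "painter_inv (Edge i c\<^sub>1 # h)"
    proof (rule go[OF _ _ 1])
      fix x assume "x \<in> {a..<b'}"
      then show "pos l' x' c\<^sub>1 < pos l x c\<^sub>1"
        using sub by (intro c(3)) (auto simp: b'_def split: if_splits)
    qed (auto simp: b'_def)
    then show ?thesis using c(1) by blast
  next
    case 2
    have "painter_inv (Edge i c\<^sub>2 # h)"
    proof (rule go[OF _ _ 2])
      fix x assume "x \<in> {a'..<b}"
      then show "pos l' x' c\<^sub>2 < pos l x c\<^sub>2"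
        using sub by (intro c(4)) (auto simp: a'_def)
    qed (auto simp: a'_def)
    then show ?thesis using c(2) by blast
  qed
qed

text \<open>The interval of the current vertex is nonempty, and putting this vertex on any of its
  points completes a strictly increasing labelling with values below \<open>N\<close>. Later numbers
  carry no edges and get 0.\<close>

lemma painter_state_no_mono_path:
  assumes "painter_state h"
  shows "\<not> has_mono_path (Suc N) h"
proof -
  let ?t = "num_vertices h"
  obtain l S C f a b d e where st: "l < M" "filled l S C e"
    "labelled h l S f ?t" "undecided h l S f a b d"
    using assms unfolding painter_state_def by blast
  have "0 < 2 ^ d * card ({a..<b} - S)" using st(4) unfolding undecided_def by linarith
  then have "{a..<b} \<noteq> {}" by (metis card.empty empty_Diff less_irrefl mult_0_right)
  then obtain x where x: "x \<in> {a..<b}" by blast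
  define g where "g v c = (if v < ?t then pos (fst (f v)) (snd (f v)) c
    else if v = ?t then pos l x c else 0)" for v c
  have pos: "pos k y c < N" if "y \<in> line k" for k y c
    using that by (auto simp: line_def intro: pos_less)
  show ?thesis
  proof (rule no_mono_path_of_labelling)
    show "g i c < g j c" if "colouring h (i, j) = Some c" for i j c
    proof -
      have "i < j" "j \<le> ?t" "j < ?t \<longrightarrow> pos (fst (f i)) (snd (f i)) c < pos (fst (f j)) (snd (f j)) c"
        using st(3) that by (auto simp: labelled_def)
      then show ?thesis using st(4) that x by (auto simp: g_def undecided_def)
    qed
    show "g v c < N" for v c
      using st(3,4) x pos N_pos by (auto simp: g_def labelled_def undecided_def subset_iff)
  qed (use N_pos in auto)
qed

lemma builder_guarantees_ge:
  assumes "builder_guarantees q (Suc N) m"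
  shows "K * weight M \<le> m"
proof -
  obtain \<pi> where \<pi>: "painter_strategy q \<pi>" "\<And>\<beta> k. builder_strategy \<beta> \<Longrightarrow> painter_inv (play \<beta> \<pi> k)"
    using painter_strategy_of_invariant[OF q_pos painter_inv_Nil painter_inv_Vertex painter_inv_Edge]
    by blast
  obtain \<beta> where "builder_strategy \<beta>"
    "\<forall>\<pi>. painter_strategy q \<pi> \<longrightarrow> (\<exists>k. has_mono_path (Suc N) (play \<beta> \<pi> k) \<and>
      card (drawn_edges (play \<beta> \<pi> k)) \<le> m)"
    using assms unfolding builder_guarantees_def by blast
  then obtain k where "has_mono_path (Suc N) (play \<beta> \<pi> k)" "card (drawn_edges (play \<beta> \<pi> k)) \<le> m"
    "painter_inv (play \<beta> \<pi> k)" using \<pi> by blast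
  then show ?thesis using painter_state_no_mono_path by (auto simp: painter_inv_def)
qed

end

section \<open>The antidiagonals of the grid as a line system\<close>

text \<open>If the quotients by \<open>N\<close> differ, a higher digit works by induction;
  otherwise the last digit decides. Painter answers in the colour of this digit when the earlier
  point has a smaller \<open>z\<close>.\<close>

lemma exists_digit_less:
  fixes z z' N k :: nat
  assumes "z' < z" "z < N ^ k"
  shows "\<exists>j<k. (z' div N ^ j) mod N < (z div N ^ j) mod N"
  using assms
proof (induction k arbitrary: z z')
  case (Suc k)
  have "0 < N" using Suc.prems(2) by (cases N) auto
  show ?case
  proof (cases "z' div N < z div N")
    case True
    have "z div N < N ^ k" using Suc.prems(2) by (intro less_mult_imp_div_less) (simp add: mult.commute)
    from Suc.IH[OF True this] obtain j where "j < k"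
      "(z' div N div N ^ j) mod N < (z div N div N ^ j) mod N" by blast
    then show ?thesis by (intro exI[of _ "Suc j"]) (simp add: div_mult2_eq)
  next
    case False
    then have "z' div N = z div N" using Suc.prems(1) by (metis div_le_mono le_neq_implies_less less_imp_le)
    then have "z' mod N < z mod N"
      using Suc.prems(1) by (metis div_mult_mod_eq nat_add_left_cancel_less)
    then show ?thesis by (intro exI[of _ 0]) simp
  qed
qed simp

text \<open>
  Line \<open>z * (2 * N - 1) + s\<close> is the antidiagonal \<open>(x, s - x)\<close> in the first two colours, the other
  \<open>q - 2\<close> coordinates being the base \<open>N\<close> digits of \<open>z\<close>.
\<close>

definition diag_pos :: "nat \<Rightarrow> nat \<Rightarrow> nat \<Rightarrow> nat \<Rightarrow> nat" where
  "diag_pos N l x c =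
     (if c = 0 then x else if c = 1 then l mod (2 * N - 1) - x
      else l div (2 * N - 1) div N ^ (c - 2) mod N)"

text \<open>If the blocks \<open>z\<close> differ, one digit colour serves for both sides and all
  \<open>x\<close>. Within a block the antidiagonal sum does not decrease, so colour 1, with
  coordinate \<open>s - x\<close>, handles smaller \<open>x\<close>, and colour 0 handles larger
  \<open>x\<close>.\<close>

lemma line_system_diag:
  assumes "2 \<le> q" "0 < N" "0 < R"
  shows "line_system q N (N ^ (q - 2) * (2 * N - 1)) R K (2 * R * 2 ^ K)
    (2 * R * 2 ^ K + N div R + 1) (\<lambda>l. l mod (2 * N - 1) + 1 - N)
    (\<lambda>l. min N (l mod (2 * N - 1) + 1)) (diag_pos N)"
proof
  fix l' l x' :: nat
  let ?B = "2 * N - 1"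
  assume l: "l' \<le> l" "l < N ^ (q - 2) * ?B" and x': "l' mod ?B + 1 - N \<le> x'" "x' < min N (l' mod ?B + 1)"
  show "\<exists>c\<^sub>1<q. \<exists>c\<^sub>2<q. \<forall>x. l mod ?B + 1 - N \<le> x \<longrightarrow> x < min N (l mod ?B + 1) \<longrightarrow>
        (x < x' \<or> x = x' \<and> l' < l \<longrightarrow> diag_pos N l' x' c\<^sub>1 < diag_pos N l x c\<^sub>1) \<and>
        (x' < x \<longrightarrow> diag_pos N l' x' c\<^sub>2 < diag_pos N l x c\<^sub>2)"
  proof (cases "l' div ?B < l div ?B")
    case True
    obtain j where "j < q - 2" "(l' div ?B div N ^ j) mod N < (l div ?B div N ^ j) mod N"
      using exists_digit_less[OF True less_mult_imp_div_less[OF l(2)]] by blast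
    then have "j + 2 < q" "\<forall>x. diag_pos N l' x' (j + 2) < diag_pos N l x (j + 2)"
      by (auto simp: diag_pos_def)
    then show ?thesis by blast
  next
    case False
    then have eq: "l' div ?B = l div ?B" using l(1) by (metis div_le_mono le_neq_implies_less)
    have mod: "l mod ?B = l - l div ?B * ?B" "l' mod ?B = l' - l div ?B * ?B"
      using eq by (metis minus_div_mult_eq_mod)+
    have le: "l' mod ?B \<le> l mod ?B" using l(1) mod by linarith
    have less: "l' mod ?B < l mod ?B" if "l' < l"
      using that eq by (metis div_mult_mod_eq nat_add_left_cancel_less)
    have "x < x' \<or> x = x' \<and> l' < l \<longrightarrow> l' mod ?B - x' < l mod ?B - x" if "x < min N (l mod ?B + 1)" for x
      using that le less x' by auto
    then show ?thesis using assms(1) by (intro exI[of _ 1] exI[of _ 0] conjI) (auto simp: diag_pos_def)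
  qed
qed (use assms in \<open>auto simp: diag_pos_def\<close>)

text \<open>Double counting: the column \<open>x\<close> meets exactly the \<open>N\<close>
  antidiagonals \<open>s \<in> {x..<x + N}\<close>.\<close>

lemma sum_card_antidiagonals:
  assumes "0 < N"
  shows "(\<Sum>s<2 * N - 1. card {s + 1 - N..<min N (s + 1)}) = N * N"
proof -
  have "card {s + 1 - N..<min N (s + 1)} = (\<Sum>x<N. if s \<in> {x..<x + N} then 1 else 0)" for s
  proof -
    have "{s + 1 - N..<min N (s + 1)} = {x\<in>{..<N}. s \<in> {x..<x + N}}" by auto
    then show ?thesis by (simp add: sum.If_cases Collect_conj_eq lessThan_def)
  qed
  then have "(\<Sum>s<2 * N - 1. card {s + 1 - N..<min N (s + 1)})
      = (\<Sum>x<N. \<Sum>s<2 * N - 1. if s \<in> {x..<x + N} then 1 else 0)"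
    by (simp only:) (rule sum.swap)
  also have "\<dots> = (\<Sum>x<N. N)"
  proof (rule sum.cong)
    fix x assume "x \<in> {..<N}"
    then have "{..<2 * N - 1} \<inter> {x..<x + N} = {x..<x + N}" by auto
    then show "(\<Sum>s<2 * N - 1. if s \<in> {x..<x + N} then 1 else 0) = N"
      by (simp only: sum.If_cases finite_lessThan Collect_mem_eq) simp
  qed simp
  finally show ?thesis by simp
qed

lemma sum_mod_eq:
  fixes g :: "nat \<Rightarrow> nat"
  shows "(\<Sum>l<A * B. g (l mod B)) = A * (\<Sum>s<B. g s)"
proof -
  have "(\<Sum>l=m * B..<m * B + B. g (l mod B)) = (\<Sum>s<B. g s)" for m
  proof -
    have "(\<Sum>l=m * B..<m * B + B. g (l mod B)) = (\<Sum>l=0..<B. g ((l + m * B) mod B))"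
      using sum.shift_bounds_nat_ivl[of "\<lambda>l. g (l mod B)" 0 "m * B" B] by (simp add: add.commute)
    then show ?thesis by (simp add: atLeast0LessThan)
  qed
  then show ?thesis using sum.nat_group[of "\<lambda>l. g (l mod B)" B A] by simp
qed

text \<open>The lines partition the \<open>N ^ q\<close> grid points, and at most
  \<open>2 * N ^ (q - 1)\<close> lines each write off at most \<open>X\<close> of them.\<close>

lemma builder_guarantees_lower:
  assumes "builder_guarantees q (Suc N) m" "2 \<le> q" "0 < N" "0 < R"
  shows "real K * (real N ^ q - 2 * real N ^ (q - 1) * real (2 * R * 2 ^ K + N div R + 1)) \<le> real m"
proof -
  define X where "X = 2 * R * 2 ^ K + N div R + 1"
  let ?M = "N ^ (q - 2) * (2 * N - 1)"
  interpret line_system q N ?M R K "2 * R * 2 ^ K" "2 * R * 2 ^ K + N div R + 1"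
    "\<lambda>l. l mod (2 * N - 1) + 1 - N" "\<lambda>l. min N (l mod (2 * N - 1) + 1)" "diag_pos N"
    using line_system_diag assms by blast
  obtain p where p: "q = Suc (Suc p)" using assms(2) by (metis add_2_eq_Suc le_Suc_ex)
  have "(\<Sum>l<?M. card (line l)) = N ^ (q - 2) * (N * N)"
    unfolding line_def using sum_mod_eq[of "\<lambda>s. card {s + 1 - N..<min N (s + 1)}"]
      sum_card_antidiagonals[OF assms(3)] by simp
  then have total: "(\<Sum>l<?M. real (card (line l))) = real N ^ q"
    by (simp add: p flip: of_nat_sum)
  have "real N ^ q - 2 * real N ^ (q - 1) * real X \<le> (\<Sum>l<?M. real (card (line l))) - real ?M * real X"
  proof -
    have "?M \<le> N ^ (q - 2) * (2 * N)" by (intro mult_le_mono2) simp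
    then have "real ?M \<le> 2 * real N ^ (q - 1)"
      unfolding of_nat_le_iff[where 'a = real, symmetric] by (simp add: p mult_ac)
    then show ?thesis unfolding total by (intro diff_left_mono mult_right_mono) auto
  qed
  also have "\<dots> = (\<Sum>l<?M. real (card (line l)) - real X)" by (simp add: sum_subtractf)
  also have "\<dots> \<le> (\<Sum>l<?M. real (card (line l) - X))" by (intro sum_mono) linarith
  also have "\<dots> = real (weight ?M)" unfolding weight_def X_def by (rule of_nat_sum[symmetric])
  finally have "real K * (real N ^ q - 2 * real N ^ (q - 1) * real X) \<le> real K * real (weight ?M)"
    by (rule mult_left_mono) simp
  also have "\<dots> \<le> real m" using builder_guarantees_ge[OF assms(1)] by (metis of_nat_le_iff of_nat_mult)
  finally show ?thesis by (simp add: X_def)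
qed

section \<open>Asymptotics\<close>

lemma V2_le: "builder_guarantees q n m \<Longrightarrow> V2 q n \<le> m"
  unfolding V2_def by (rule Least_le)

text \<open>Each query shrinks the candidates by the factor \<open>b\<close>, so \<open>E\<close> is
  just above \<open>log b y\<close>. The freedom in \<open>y\<close> permits the sharp value
  \<open>n\<close> for \<open>q = 2\<close> and the uniform value \<open>n ^ q\<close> where
  constants do not matter.\<close>

lemma builder_guarantees_log:
  fixes b y :: real
  assumes "2 \<le> q" "2 \<le> n" "1 < b" "1 \<le> y"
    and "q = 2 \<Longrightarrow> b = 2 \<and> real n \<le> y" "q \<noteq> 2 \<Longrightarrow> b = real q / real (q - 1) \<and> real n ^ q \<le> y"
  shows "\<exists>m. builder_guarantees q n m \<and> real m \<le> (real n ^ q + 2) * (log b y + 1) + 1"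
proof -
  define E where "E = nat \<lfloor>log b y\<rfloor> + 1"
  have E: "d < E" if "b ^ d \<le> y" for d
  proof -
    have "real d \<le> log b y" using that assms(3,4) by (simp add: le_log_iff powr_realpow)
    then show ?thesis unfolding E_def by linarith
  qed
  have "builder_guarantees q n (((n - 1) ^ q + 2) * E + 1)"
  proof (rule builder_guarantees_bound[OF assms(1,2)])
    fix d assume q: "q \<noteq> 2" and "q ^ d \<le> (q - 1) ^ d * n ^ q"
    then have "real (q ^ d) \<le> real ((q - 1) ^ d * n ^ q)" by (simp only: of_nat_le_iff)
    then have "real q ^ d / real (q - 1) ^ d \<le> real n ^ q"
      using assms(1) by (simp add: pos_divide_le_eq mult.commute)
    then have "b ^ d \<le> real n ^ q" using assms(6) q by (simp add: power_divide)
    then show "d < E" using assms(6) q by (intro E) simp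
  next
    fix d assume q: "q = 2" and "2 ^ d \<le> n"
    then have "real (2 ^ d) \<le> real n" by (simp only: of_nat_le_iff)
    then have "b ^ d \<le> y" using assms(5)[OF q] by (metis of_nat_numeral of_nat_power order_trans)
    then show "d < E" by (rule E)
  qed
  moreover have "real (((n - 1) ^ q + 2) * E + 1) \<le> (real n ^ q + 2) * (log b y + 1) + 1"
  proof -
    have "0 \<le> log b y" using assms(3,4) by simp
    then have "real E \<le> log b y + 1" unfolding E_def by linarith
    moreover have "real (n - 1) ^ q \<le> real n ^ q" by (intro power_mono) auto
    ultimately have "(real (n - 1) ^ q + 2) * real E \<le> (real n ^ q + 2) * (log b y + 1)"
      by (intro mult_mono) auto
    then show ?thesis by (simp add: algebra_simps)
  qed
  ultimately show ?thesis by blast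
qed

lemma V2_two_upper:
  assumes "2 \<le> n"
  shows "real (V2 2 n) \<le> (real n ^ 2 + 2) * (log 2 (real n) + 1) + 1"
proof -
  obtain m where m: "builder_guarantees 2 n m" "real m \<le> (real n ^ 2 + 2) * (log 2 (real n) + 1) + 1"
    using builder_guarantees_log[of 2 n 2 "real n"] assms by auto
  then show ?thesis using V2_le[OF m(1)] by linarith
qed

lemma builder_guarantees_exists:
  assumes "2 \<le> q"
  obtains c' :: real where "0 < c'"
    "\<And>n. 2 \<le> n \<Longrightarrow> \<exists>m. builder_guarantees q n m \<and> real m \<le> c' * real n ^ q * log 2 (real n)"
proof -
  define b where "b = real q / real (q - 1)"
  define D where "D = real q / log 2 b + 1"
  have b: "1 < b" "q = 2 \<Longrightarrow> b = 2" using assms by (auto simp: b_def field_simps)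
  have lb: "0 < log 2 b" using b by simp
  then have D: "0 < D" by (auto simp: D_def intro!: add_nonneg_pos)
  show ?thesis
  \<comment> \<open>The 3 absorbs \<open>n ^ q + 2 \<le> 3 * n ^ q\<close>, \<open>D\<close> absorbs
    the logarithm together with its \<open>+ 1\<close>, and the last 1 covers the final
    edge.\<close>
  proof (rule that[of "3 * D + 1"])
    fix n :: nat assume n: "2 \<le> n"
    define T where "T = log 2 (real n)"
    have T: "1 \<le> T" using n by (simp add: T_def le_log_iff)
    have P: "1 \<le> real n ^ q" using n by (intro one_le_power) simp
    have "real n ^ 1 \<le> real n ^ q" using assms n by (intro power_increasing) auto
    then obtain m where m: "builder_guarantees q n m"
      "real m \<le> (real n ^ q + 2) * (log b (real n ^ q) + 1) + 1"
      using builder_guarantees_log[of q n b "real n ^ q"] assms n b P by (auto simp: b_def)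
    have "log b (real n ^ q) = real q / log 2 b * T"
      using n b by (simp add: log_nat_power T_def log_base_change[of 2 b])
    then have "0 \<le> log b (real n ^ q)" "log b (real n ^ q) + 1 \<le> D * T"
      using T lb by (auto simp: D_def algebra_simps)
    then have "(real n ^ q + 2) * (log b (real n ^ q) + 1) \<le> (3 * real n ^ q) * (D * T)"
      using P by (intro mult_mono) auto
    moreover have "1 \<le> real n ^ q * T" using P T by (metis mult_mono mult_1 order_trans zero_le_one)
    ultimately have "real m \<le> (3 * D + 1) * real n ^ q * T"
      using m(2) by (simp add: algebra_simps)
    then show "\<exists>m. builder_guarantees q n m \<and> real m \<le> (3 * D + 1) * real n ^ q * log 2 (real n)"
      using m(1) by (auto simp: T_def)
  qed (use D in auto)
qed

text \<open>Builder's strategy shows that some \<open>m\<close> is guaranteed, so the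
  \<open>LEAST\<close> in \<open>V2\<close> is attained.\<close>

lemma builder_guarantees_V2:
  assumes "2 \<le> q" "2 \<le> n"
  shows "builder_guarantees q n (V2 q n)"
  using builder_guarantees_exists[OF assms(1)] assms(2) LeastI_ex[of "builder_guarantees q n"]
  unfolding V2_def by metis

lemma V2_pos:
  assumes "2 \<le> q" "2 \<le> n"
  shows "1 \<le> V2 q n"
proof -
  have "painter_strategy q (\<lambda>_ _. 0)" using assms(1) by (simp add: painter_strategy_def)
  then obtain h where "has_mono_path n h" "card (drawn_edges h) \<le> V2 q n"
    using builder_guarantees_V2[OF assms] unfolding builder_guarantees_def by blast
  then show ?thesis using has_mono_path_imp_drawn[OF _ assms(2)] by fastforce
qed

text \<open>With \<open>K\<close> near (1 - \<delta>) log N and \<open>R\<close> near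
  N^(\<delta>/2), both \<open>R * 2 ^ K\<close> and \<open>N div R\<close> are of order at most N^(1
  - \<delta>/2). The written-off points are thus a vanishing fraction of the grid.\<close>

lemma V2_Suc_ge:
  fixes \<delta> :: real
  assumes "2 \<le> q" "0 < \<delta>" "\<delta> < 1" "0 < N" "12 * real N powr (-\<delta>/2) \<le> 1"
  shows "((1 - \<delta>) * log 2 (real N) - 1) * (real N ^ q * (1 - 12 * real N powr (-\<delta>/2)))
    \<le> real (V2 q (Suc N))"
proof -
  define K where "K = nat \<lfloor>(1 - \<delta>) * log 2 (real N)\<rfloor>"
  define R where "R = nat \<lceil>real N powr (\<delta>/2)\<rceil>"
  define X where "X = 2 * R * 2 ^ K + N div R + 1"
  have N: "1 \<le> real N" using assms(4) by simp
  have L: "0 \<le> (1 - \<delta>) * log 2 (real N)" using N assms(3) by simp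
  have P: "1 \<le> real N powr (\<delta>/2)" using N assms(2) by (simp add: ge_one_powr_ge_zero)
  have R: "real N powr (\<delta>/2) \<le> real R" "real R \<le> 2 * real N powr (\<delta>/2)"
    using P unfolding R_def by linarith+
  then have R0: "0 < R" using P by (cases R) auto
  have K: "(1 - \<delta>) * log 2 (real N) - 1 \<le> real K" "real K \<le> (1 - \<delta>) * log 2 (real N)"
    using L unfolding K_def by linarith+
  have "(2::real) ^ K = 2 powr real K" by (simp add: powr_realpow)
  also have "\<dots> \<le> 2 powr ((1 - \<delta>) * log 2 (real N))" using K(2) by simp
  also have "\<dots> = (2 powr log 2 (real N)) powr (1 - \<delta>)" by (simp add: powr_powr mult.commute)
  also have "\<dots> = real N powr (1 - \<delta>)" using N by simp
  finally have K2: "(2::real) ^ K \<le> real N powr (1 - \<delta>)" .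
  let ?Z = "real N powr (1 - \<delta>/2)"
  have "real (2 * R * 2 ^ K) = 2 * (real R * 2 ^ K)" by simp
  also have "real R * 2 ^ K \<le> (2 * real N powr (\<delta>/2)) * real N powr (1 - \<delta>)"
    using R(2) K2 by (intro mult_mono) auto
  also have "\<dots> = 2 * ?Z" by (simp flip: powr_add)
  finally have X1: "real (2 * R * 2 ^ K) \<le> 4 * ?Z" by simp
  have "real (N div R) \<le> real N / real R" by (simp add: of_nat_div_le_of_nat)
  also have "\<dots> \<le> real N / real N powr (\<delta>/2)" using R(1) P N by (intro divide_left_mono) auto
  also have "\<dots> = ?Z" using N by (simp add: powr_diff)
  finally have X2: "real (N div R) \<le> ?Z" .
  have "1 \<le> ?Z" using N assms(3) by (simp add: ge_one_powr_ge_zero)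
  \<comment> \<open>6 = 4 + 1 + 1, one summand for each term of \<open>X\<close>; the factor 2 in
    front of the loss then gives 12.\<close>
  with X1 X2 have X: "real X \<le> 6 * ?Z" unfolding X_def by simp
  obtain p where p: "q = Suc p" using assms(1) by (cases q) auto
  have "?Z = real N * real N powr (-\<delta>/2)"
    using N powr_add[of "real N" 1 "-\<delta>/2"] by simp
  then have "2 * real N ^ (q - 1) * (6 * ?Z) = 12 * real N ^ q * real N powr (-\<delta>/2)"
    by (simp add: p)
  moreover have "2 * real N ^ (q - 1) * real X \<le> 2 * real N ^ (q - 1) * (6 * ?Z)"
    using X by (intro mult_left_mono) auto
  ultimately have main: "real N ^ q * (1 - 12 * real N powr (-\<delta>/2)) \<le> real N ^ q - 2 * real N ^ (q - 1) * real X"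
    by (simp add: algebra_simps)
  have "((1 - \<delta>) * log 2 (real N) - 1) * (real N ^ q * (1 - 12 * real N powr (-\<delta>/2)))
      \<le> real K * (real N ^ q * (1 - 12 * real N powr (-\<delta>/2)))"
    using K(1) assms(5) by (intro mult_right_mono) auto
  also have "\<dots> \<le> real K * (real N ^ q - 2 * real N ^ (q - 1) * real X)"
    using main by (intro mult_left_mono) auto
  also have "\<dots> \<le> real (V2 q (Suc N))"
    unfolding X_def using builder_guarantees_V2[OF assms(1), of "Suc N"] assms(1,4) R0
    by (intro builder_guarantees_lower) auto
  finally show ?thesis .
qed

lemma V2_eventually_ge:
  assumes "2 \<le> q" "r < 1"
  shows "\<forall>\<^sub>F n in at_top. r * (real n ^ q * log 2 (real n)) \<le> real (V2 q n)"
proof -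
  \<comment> \<open>The second entry gives \<open>r < 1 - \<delta>\<close>; the first keeps
    \<open>\<delta>\<close> below 1 when \<open>r\<close> is very negative.\<close>
  define \<delta> where "\<delta> = min (1/2) ((1 - r) / 2)"
  have \<delta>: "0 < \<delta>" "\<delta> < 1" "r < 1 - \<delta>" using assms(2) by (auto simp: \<delta>_def min_def field_simps)
  define g where "g N = ((1 - \<delta>) * log 2 (real N) - 1) * (1 - 12 * real N powr (-\<delta>/2))
    / log 2 (real (Suc N))" for N
  have "(g \<longlongrightarrow> 1 - \<delta>) at_top" unfolding g_def using \<delta> by real_asymp
  moreover have "((\<lambda>N. real N / real (Suc N)) \<longlongrightarrow> 1) at_top" by real_asymp
  ultimately have "((\<lambda>N. g N * (real N / real (Suc N)) ^ q) \<longlongrightarrow> (1 - \<delta>) * 1 ^ q) at_top"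
    by (intro tendsto_intros)
  then have ev1: "\<forall>\<^sub>F N in at_top. r < g N * (real N / real (Suc N)) ^ q"
    using \<delta>(3) by (auto dest: order_tendstoD(1))
  have ev2: "\<forall>\<^sub>F N in at_top. 12 * real N powr (-\<delta>/2) \<le> 1" using \<delta> by real_asymp
  have "\<forall>\<^sub>F N in at_top. r * (real (Suc N) ^ q * log 2 (real (Suc N))) \<le> real (V2 q (Suc N))"
    using ev1 ev2 eventually_gt_at_top[of 0]
  proof eventually_elim
    case (elim N)
    have log_pos: "0 < log 2 (real (Suc N))" using elim(3) by simp
    then have pos: "0 < real (Suc N) ^ q * log 2 (real (Suc N))" by simp
    have "r * (real (Suc N) ^ q * log 2 (real (Suc N)))
        \<le> g N * (real N / real (Suc N)) ^ q * (real (Suc N) ^ q * log 2 (real (Suc N)))"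
      using elim(1) pos by (intro mult_right_mono) auto
    also have "\<dots> = ((1 - \<delta>) * log 2 (real N) - 1) * (real N ^ q * (1 - 12 * real N powr (-\<delta>/2)))"
      using elim(3) less_imp_neq[OF log_pos] unfolding g_def power_divide by (simp del: of_nat_Suc)
    also have "\<dots> \<le> real (V2 q (Suc N))" using V2_Suc_ge[OF assms(1) \<delta>(1,2) elim(3,2)] .
    finally show ?case .
  qed
  then show ?thesis by (subst (asm) eventually_sequentially_Suc)
qed

lemma V2_two_asymp_equiv: "(\<lambda>n. real (V2 2 n)) \<sim>[at_top] (\<lambda>n. real n ^ 2 * log 2 (real n))"
proof (rule asymp_equivI')
  let ?f = "\<lambda>n. real (V2 2 n) / (real n ^ 2 * log 2 (real n))"
  have pos: "0 < real n ^ 2 * log 2 (real n)" if "2 \<le> n" for n :: nat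
    using that by simp
  show "(?f \<longlongrightarrow> 1) at_top"
  proof (rule order_tendstoI)
    fix a :: real assume "a < 1"
    \<comment> \<open>A value strictly between \<open>a\<close> and 1 turns the weak eventual bound
      into a strict one.\<close>
    then have "(a + 1) / 2 < 1" "a < (a + 1) / 2" by auto
    from V2_eventually_ge[OF order_refl this(1)] eventually_ge_at_top[of 2]
    show "\<forall>\<^sub>F n in at_top. a < ?f n"
    proof eventually_elim
      case (elim n)
      then have "(a + 1) / 2 \<le> ?f n" using pos by (simp add: pos_le_divide_eq)
      then show ?case using \<open>a < (a + 1) / 2\<close> by linarith
    qed
  next
    fix a :: real assume "1 < a"
    have "((\<lambda>n. ((real n ^ 2 + 2) * (log 2 (real n) + 1) + 1) / (real n ^ 2 * log 2 (real n))) \<longlongrightarrow> 1) at_top"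
      by real_asymp
    from order_tendstoD(2)[OF this \<open>1 < a\<close>] eventually_ge_at_top[of 2]
    show "\<forall>\<^sub>F n in at_top. ?f n < a"
    proof eventually_elim
      case (elim n)
      then show ?case using divide_right_mono[OF V2_two_upper less_imp_le[OF pos]] by fastforce
    qed
  qed
qed

text \<open>The asymptotic bound covers large \<open>n\<close>. For the finitely many others
  \<open>V2\<close> is at least 1, while the growth term is at most its value \<open>Z\<close> at
  \<open>n\<^sub>0 + 2\<close>.\<close>

lemma V2_ge_all:
  assumes "2 \<le> q"
  obtains c :: real where "0 < c" "\<And>n. 2 \<le> n \<Longrightarrow> c * real n ^ q * log 2 (real n) \<le> real (V2 q n)"
proof -
  obtain n\<^sub>0 where "\<forall>n\<ge>n\<^sub>0. 1/2 * (real n ^ q * log 2 (real n)) \<le> real (V2 q n)"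
    using V2_eventually_ge[OF assms, of "1/2"] by (auto simp: eventually_at_top_linorder)
  then have ge: "1/2 * (real n ^ q * log 2 (real n)) \<le> real (V2 q n)" if "n\<^sub>0 + 2 \<le> n" for n
    using that by simp
  define Z where "Z = real (n\<^sub>0 + 2) ^ q * log 2 (real (n\<^sub>0 + 2))"
  have Z: "0 < Z" by (simp add: Z_def)
  define c where "c = min (1/2) (1 / Z)"
  show ?thesis
  proof (rule that[of c])
    fix n :: nat assume n: "2 \<le> n"
    have nn: "0 \<le> real n ^ q * log 2 (real n)" using n by simp
    have "c * (real n ^ q * log 2 (real n)) \<le> real (V2 q n)"
    proof (cases "n\<^sub>0 + 2 \<le> n")
      case True
      have "c * (real n ^ q * log 2 (real n)) \<le> 1/2 * (real n ^ q * log 2 (real n))"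
        using nn by (intro mult_right_mono) (auto simp: c_def)
      then show ?thesis using ge[OF True] by linarith
    next
      case False
      then have "real n ^ q * log 2 (real n) \<le> Z"
        unfolding Z_def using n by (intro mult_mono power_mono) auto
      then have "c * (real n ^ q * log 2 (real n)) \<le> 1 / Z * Z"
        using nn Z by (intro mult_mono) (auto simp: c_def)
      then show ?thesis using Z V2_pos[OF assms n] by simp
    qed
    then show "c * real n ^ q * log 2 (real n) \<le> real (V2 q n)" by (simp add: mult.assoc)
  qed (use Z in \<open>auto simp: c_def\<close>)
qed

theorem theorem5:
  shows "((\<lambda>n. real (V2 2 n)) \<sim>[at_top] (\<lambda>n. real n ^ 2 * log 2 (real n))) \<and>
    (\<forall>q\<ge>2. \<exists>c>0. \<exists>c'>0. \<forall>n\<ge>2.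
       c * real n ^ q * log 2 (real n) \<le> real (V2 q n) \<and>
       real (V2 q n) \<le> c' * real n ^ q * log 2 (real n))"
proof (intro conjI V2_two_asymp_equiv allI impI)
  fix q :: nat assume q: "2 \<le> q"
  obtain c :: real where c: "0 < c" "\<And>n. 2 \<le> n \<Longrightarrow> c * real n ^ q * log 2 (real n) \<le> real (V2 q n)"
    using V2_ge_all[OF q] by blast
  obtain c' :: real where c': "0 < c'"
    "\<And>n. 2 \<le> n \<Longrightarrow> \<exists>m. builder_guarantees q n m \<and> real m \<le> c' * real n ^ q * log 2 (real n)"
    using builder_guarantees_exists[OF q] by blast
  have "real (V2 q n) \<le> c' * real n ^ q * log 2 (real n)" if "2 \<le> n" for n
    using c'(2)[OF that] V2_le by (meson of_nat_le_iff order_trans)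
  then show "\<exists>c>0. \<exists>c'>0. \<forall>n\<ge>2. c * real n ^ q * log 2 (real n) \<le> real (V2 q n) \<and>
       real (V2 q n) \<le> c' * real n ^ q * log 2 (real n)"
    using c c'(1) by blast
qed

end
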